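(* Let $n\ge 1$, $m\ge 1$, let $\Psi:[0,\infty)\to[0,\infty)$ be non-decreasing with $\lim_{u\to\infty}\Psi(u)=\infty$, and for $1\le k\le n$ let $p_k:[0,1]\to[0,1]$ be continuous and non-decreasing with $p_k(0)=0$. Let $f:[0,1]^n\to\mathbb{R}^m$ be a continuous function and suppose that $$\int_{[0,1]^{n}}\int_{[0,1]^{n}}\Psi\left(\frac{|\square_{y}^{n}f(x)|}{\prod_{k=1}^{n}p_{k}(|x_{k}-y_{k}|)}\right)dx\,dy\le B<\infty .$$ Then for all $s,t\in[0,1]^{n}$ we have $$|\square_{s}^{n}f(t)|\le 8^{n}\int_{0}^{|s_{1}-t_{1}|}\cdots\int_{0}^{|s_{n}-t_{n}|}\Psi^{-1}\left(\frac{4^{n}B}{u_{1}^{2}\cdots u_{n}^{2}}\right)dp_{1}(u_{1})\cdots dp_{n}(u_{n}).$$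
   Context: For $x=(x_1,\dots,x_n)$ and $y=(y_1,\dots,y_n)$, put $V_{k,y}x=(x_1,\dots,x_{k-1},y_k,x_{k+1},\dots,x_n)$ and, for a function $f$, $V_{k,y}f(x)=f(V_{k,y}x)$. The operators $V_{k,y}$, $1\le k\le n$, commute. The joint (rectangular) increment of $f$ is $\square_y^n f(x)=\prod_{k=1}^n (I-V_{k,y})f(x)$, where $I$ is the identity operator; e.g. for $n=2$, $\square_y^2f(x)=f(x_1,x_2)-f(y_1,x_2)-f(x_1,y_2)+f(y_1,y_2)$. The generalized inverse of $\Psi$ is $\Psi^{-1}(u)=\sup\{v\ge 0:\Psi(v)\le u\}$ for $\Psi(0)\le u<\infty$. The integrals with respect to $dp_k$ are Lebesgue–Stieltjes integrals. Degenerate quotients are read as $0/0=0$ and $a/0=+\infty$ for $a>0$, with $\Psi(+\infty)=+\infty$. *)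

theory Defs
  imports "HOL-Analysis.Analysis"
begin

definition subst_coord :: "'n::finite \<Rightarrow> real ^ 'n \<Rightarrow> real ^ 'n \<Rightarrow> real ^ 'n"
  where "subst_coord k y x = (\<chi> i. if i = k then y $ i else x $ i)"

definition V_op ::
    "'n::finite \<Rightarrow> real ^ 'n \<Rightarrow> (real ^ 'n \<Rightarrow> 'b) \<Rightarrow> real ^ 'n \<Rightarrow> 'b"
  where "V_op k y f = (\<lambda>x. f (subst_coord k y x))"

text \<open>The operator \<open>I - V\<^sub>k\<^sub>,\<^sub>y\<close>.\<close>

definition diff_op ::
    "'n::finite \<Rightarrow> real ^ 'n \<Rightarrow> (real ^ 'n \<Rightarrow> 'b::ab_group_add) \<Rightarrow> real ^ 'n \<Rightarrow> 'b"
  where "diff_op k y f = (\<lambda>x. f x - V_op k y f x)"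

text \<open>The factors of the operator product \<open>\<Prod>\<^sub>k (I - V\<^sub>k\<^sub>,\<^sub>y)\<close> commute, so it can be
  written as a fold over the unordered index set.\<close>

definition rect_increment ::
    "real ^ 'n::finite \<Rightarrow> (real ^ 'n \<Rightarrow> 'b::ab_group_add) \<Rightarrow> real ^ 'n \<Rightarrow> 'b"
  where "rect_increment y f = Finite_Set.fold (\<lambda>k. diff_op k y) f UNIV"

lemma subst_coord_commute:
  "subst_coord j y (subst_coord k y x) = subst_coord k y (subst_coord j y x)"
  by (simp add: subst_coord_def vec_eq_iff)

lemma comp_fun_commute_diff_op: "comp_fun_commute (\<lambda>k. diff_op k y)"
  by unfold_locales
     (auto simp: fun_eq_iff diff_op_def V_op_def subst_coord_commute algebra_simps)

lemma rect_increment_2: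
  fixes f :: "real ^ 2 \<Rightarrow> 'b::ab_group_add"
  shows "rect_increment y f x =
    f (vector [x $ 1, x $ 2]) - f (vector [y $ 1, x $ 2])
    - f (vector [x $ 1, y $ 2]) + f (vector [y $ 1, y $ 2])"
proof -
  interpret comp_fun_commute "\<lambda>k. diff_op k y"
    by (rule comp_fun_commute_diff_op)
  have *: "x = vector [x $ 1, x $ 2]"
      "subst_coord 1 y x = vector [y $ 1, x $ 2]"
      "subst_coord 2 y x = vector [x $ 1, y $ 2]"
      "subst_coord 1 y (subst_coord 2 y x) = vector [y $ 1, y $ 2]"
    by (simp_all add: vec_eq_iff forall_2 subst_coord_def)
  have "rect_increment y f x = diff_op 1 y (diff_op 2 y f) x"
    by (simp add: rect_increment_def UNIV_2)
  also have "\<dots> = f x - f (subst_coord 1 y x) - f (subst_coord 2 y x)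
      + f (subst_coord 1 y (subst_coord 2 y x))"
    by (simp add: diff_op_def V_op_def subst_coord_commute[of 2 y 1] algebra_simps)
  finally show ?thesis
    unfolding *(4) unfolding *(2,3) arg_cong[where f = f, OF *(1), symmetric] .
qed

text \<open>\<open>\<Psi>\<close> extended by \<open>\<Psi>(+\<infinity>) = +\<infinity>\<close>. The quotients it is applied to are formed in \<open>ennreal\<close>,
  where \<open>0 / 0 = 0\<close> and \<open>a / 0 = \<infinity>\<close> for \<open>a > 0\<close>.\<close>

definition ext_Psi :: "(real \<Rightarrow> real) \<Rightarrow> ennreal \<Rightarrow> ennreal"
  where "ext_Psi \<Psi> u = (if u = \<infinity> then \<infinity> else ennreal (\<Psi> (enn2real u)))"

lemma ennreal_quotient_conventions:
  "(0::ennreal) / 0 = 0" "0 < a \<Longrightarrow> (a::ennreal) / 0 = \<infinity>"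
  by (simp_all add: ennreal_divide_zero)

text \<open>The supremum is taken in \<open>ennreal\<close>, so that the value at \<open>\<infinity>\<close> is \<open>\<infinity>\<close>; for
  \<open>\<Psi> 0 \<le> u < \<infinity>\<close> it is the ordinary real supremum.\<close>

definition gen_inverse :: "(real \<Rightarrow> real) \<Rightarrow> ennreal \<Rightarrow> ennreal"
  where "gen_inverse \<Psi> u = (SUP v\<in>{v. 0 \<le> v \<and> ennreal (\<Psi> v) \<le> u}. ennreal v)"

lemma gen_inverse_eq_real_Sup:
  assumes nonneg: "\<And>v. 0 \<le> v \<Longrightarrow> 0 \<le> \<Psi> v"
    and lim: "filterlim \<Psi> at_top at_top"
    and u: "\<Psi> 0 \<le> u"
  shows "gen_inverse \<Psi> (ennreal u) = ennreal (Sup {v. 0 \<le> v \<and> \<Psi> v \<le> u})"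
proof -
  let ?S = "{v. 0 \<le> v \<and> \<Psi> v \<le> u}"
  have u0: "0 \<le> u"
    using nonneg[of 0] u by simp
  have S: "{v. 0 \<le> v \<and> ennreal (\<Psi> v) \<le> ennreal u} = ?S"
    using u0 nonneg by (auto simp: ennreal_le_iff)
  have "eventually (\<lambda>v. u + 1 \<le> \<Psi> v) at_top"
    using lim by (simp add: filterlim_at_top)
  then obtain N where N: "\<And>v. N \<le> v \<Longrightarrow> u + 1 \<le> \<Psi> v"
    by (auto simp: eventually_at_top_linorder)
  have ne: "?S \<noteq> {}"
    using u by auto
  have bdd: "bdd_above ?S"
  proof (rule bdd_aboveI)
    fix v assume "v \<in> ?S"
    with N[of v] show "v \<le> N"
      by (cases "N \<le> v") auto
  qed
  have "ennreal (Sup ?S) = (SUP v\<in>?S. ennreal v)"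
  proof (rule continuous_at_Sup_mono)
    show "mono ennreal"
      by (auto simp: mono_def ennreal_leI)
    show "continuous (at_left (Sup ?S)) ennreal"
      by (simp add: continuous_within tendsto_ennrealI)
  qed (use ne bdd in auto)
  then show ?thesis
    by (simp add: gen_inverse_def S)
qed

text \<open>The Lebesgue--Stieltjes measure \<open>dp\<close> of \<open>p : [0,1] \<rightarrow> \<real>\<close>, extended by constants
  outside \<open>[0,1]\<close>; the extension adds no mass.\<close>

definition stieltjes :: "(real \<Rightarrow> real) \<Rightarrow> real measure"
  where "stieltjes p = interval_measure (\<lambda>u. p (max 0 (min 1 u)))"

end

theory Submission
  imports Defs
begin

text \<open>The heart of the matter is a form of the one-dimensional Garsia--Rodemich--Rumsey inequality
  that can be iterated.  Since \<open>\<Psi> v \<le> b\<close> gives \<open>v \<le> \<Psi>\<^sup>-\<^sup>1 b\<close>, the integral condition on \<open>f\<close> has the shape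

    \<open>|increment of f between x and y| \<le> p(|x - y|) \<cdot> G (b x y)\<close> wherever \<open>b x y < \<infinity>\<close>,
    and the double integral of \<open>b\<close> is at most \<open>B\<close>,

  where \<open>G = \<Psi>\<^sup>-\<^sup>1\<close> and, in several dimensions, \<open>p(|x - y|)\<close> stands for the product of the
  \<open>p\<^sub>k(|x\<^sub>k - y\<^sub>k|)\<close>.  In one dimension, the classical argument uses only that \<open>G\<close> is monotone and
  bounds the increment between \<open>s\<close> and \<open>t\<close> by \<open>8 \<integral> G (4B / u\<^sup>2) dp(u)\<close>, integrated over
  \<open>0 \<le> u \<le> |s - t|\<close> (\<open>increment_bound_1d\<close>).

  In several dimensions one cannot simply build one chain of points in every coordinate, because the
  points chosen in one coordinate would have to be good for all the points chosen in the others.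
  Instead, one coordinate \<open>k\<close> is treated at a time.  For fixed remaining coordinates \<open>x'\<close>, \<open>y'\<close>, the
  one-dimensional bound applies to the rectangular increment in \<open>x'\<close>, \<open>y'\<close> as a function of the
  \<open>k\<close>-th coordinate, with \<open>b' x' y'\<close>, the integral of \<open>b\<close> over \<open>x\<^sub>k\<close> and \<open>y\<^sub>k\<close>, in the place of \<open>B\<close>.
  The result is again a condition of the shape above in one dimension less: \<open>f\<close> is replaced by its
  difference in coordinate \<open>k\<close>, \<open>b\<close> by \<open>b'\<close>, and \<open>G\<close> by the function
  \<open>G' v = 8 \<integral> G (4v / u\<^sup>2) dp\<^sub>k(u)\<close>, integrated over \<open>0 \<le> u \<le> |s\<^sub>k - t\<^sub>k|\<close>, which is again
  monotone.  Induction
  (\<open>partial_increment_bound\<close>) composes these transformations into the iterated integral.  Working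
  with the inverse \<open>G\<close> from the outset is what makes this possible: \<open>G'\<close> need not be the inverse
  of any function in a convenient class.\<close>

section \<open>Points with small integral values\<close>

text \<open>The set where a monotone function exceeds a level is upward closed, hence a closed or an
  open ray.\<close>

lemma borel_measurable_mono_ennreal:
  fixes G :: "ennreal \<Rightarrow> ennreal"
  assumes "mono G"
  shows "G \<in> borel_measurable borel"
proof (rule borel_measurableI_greater)
  fix y
  define U where "U = {x. y < G x}"
  have up: "z \<in> U" if "x \<in> U" "x \<le> z" for x z
    using that monoD[OF assms, of x z] by (auto simp: U_def)
  have gt: "z \<in> U" if "Inf U < z" for z
    using that up by (auto simp: Inf_less_iff intro: less_imp_le)
  have "U = {Inf U..} \<or> U = {Inf U<..}"
  proof (cases "Inf U \<in> U")
    case True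
    then have "U = {Inf U..}" using up by (auto intro: Inf_lower)
    then show ?thesis ..
  next
    case False
    then have "U = {Inf U<..}"
      using gt by (auto simp: less_le intro: Inf_lower)
    then show ?thesis ..
  qed
  then have "U \<in> sets borel" by (metis atLeast_borel greaterThan_borel)
  then show "{x \<in> space borel. y < G x} \<in> sets borel" by (simp add: U_def)
qed

lemma exists_le_average:
  fixes w :: "real \<Rightarrow> ennreal"
  assumes [measurable]: "w \<in> borel_measurable borel"
    and le: "(\<integral>\<^sup>+x. w x \<partial>lborel) \<le> K" and K: "K < \<infinity>" and ab: "a < b"
  shows "\<exists>x\<in>{a<..<b}. w x \<le> K / ennreal (b - a)"
proof (rule ccontr)
  assume contra: "\<not> ?thesis"
  let ?S = "{a<..<b}"
  let ?k = "K / ennreal (b - a)"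
  have ba: "ennreal (b - a) \<noteq> 0" "ennreal (b - a) < \<infinity>" using ab by auto
  have int_k: "(\<integral>\<^sup>+x. ?k * indicator ?S x \<partial>lborel) = K"
    using ab ba by (subst nn_integral_cmult_indicator) (simp_all add: ennreal_divide_times)
  have "(\<integral>\<^sup>+x. ?k * indicator ?S x \<partial>lborel) < (\<integral>\<^sup>+x. w x * indicator ?S x \<partial>lborel)"
  proof (rule nn_integral_less)
    show "(\<integral>\<^sup>+x. ?k * indicator ?S x \<partial>lborel) \<noteq> \<infinity>" using K unfolding int_k by auto
    show "AE x in lborel. ?k * indicator ?S x \<le> w x * indicator ?S x"
      using contra by (intro AE_I2) (auto simp: indicator_def not_le intro: less_imp_le)
    show "\<not> (AE x in lborel. w x * indicator ?S x \<le> ?k * indicator ?S x)"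
    proof
      assume "AE x in lborel. w x * indicator ?S x \<le> ?k * indicator ?S x"
      then have "AE x in lborel. x \<notin> ?S"
      proof eventually_elim
        case (elim x)
        then show ?case using contra by (cases "x \<in> ?S") auto
      qed
      then have "emeasure lborel ?S = 0" by (subst (asm) AE_iff_measurable[of ?S]) auto
      then show False using ab by simp
    qed
  qed auto
  also have "\<dots> \<le> (\<integral>\<^sup>+x. w x \<partial>lborel)"
    by (intro nn_integral_mono) (auto simp: indicator_def)
  finally show False using le int_k by (metis leD)
qed

text \<open>Two functions can be kept below twice their averages at the same point: after division by
  their integral bounds, their sum has integral at most 2, so at some point it is at most the
  average of that.  If a bound is 0, the quotient convention of \<^typ>\<open>ennreal\<close> turns the finiteness
  of the quotient into the vanishing of the function at that point.\<close>

lemma exists_le_twice_average2: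
  fixes g h :: "real \<Rightarrow> ennreal"
  assumes [measurable]: "g \<in> borel_measurable borel" "h \<in> borel_measurable borel"
    and g: "(\<integral>\<^sup>+x. g x \<partial>lborel) \<le> K" and h: "(\<integral>\<^sup>+x. h x \<partial>lborel) \<le> L"
    and KL: "K < \<infinity>" "L < \<infinity>" and ab: "a < b"
  shows "\<exists>x\<in>{a<..<b}. g x \<le> 2 * K / ennreal (b - a) \<and> h x \<le> 2 * L / ennreal (b - a)"
proof -
  have int1: "(\<integral>\<^sup>+x. v x / A \<partial>lborel) \<le> 1"
    if "(\<integral>\<^sup>+x. v x \<partial>lborel) \<le> A" "A < \<infinity>" and [measurable]: "v \<in> borel_measurable borel"
    for v :: "real \<Rightarrow> ennreal" and A
  proof -
    have "(\<integral>\<^sup>+x. v x / A \<partial>lborel) = (\<integral>\<^sup>+x. v x \<partial>lborel) / A"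
      by (simp add: nn_integral_divide)
    also have "\<dots> \<le> A / A" using that by (simp add: divide_right_mono_ennreal)
    also have "\<dots> \<le> 1" using that by (cases "A = 0") auto
    finally show ?thesis .
  qed
  have le2: "(\<integral>\<^sup>+x. g x / K + h x / L \<partial>lborel) \<le> 2"
    using add_mono[OF int1[OF g KL(1)] int1[OF h KL(2)]] by (simp add: nn_integral_add)
  obtain x where x: "x \<in> {a<..<b}" "g x / K + h x / L \<le> 2 / ennreal (b - a)"
    using exists_le_average[OF _ le2 _ ab] by auto
  have unnormalize: "v \<le> 2 * A / ennreal (b - a)" if "v / A \<le> 2 / ennreal (b - a)" "A < \<infinity>" for v A :: ennreal
  proof (cases "A = 0")
    case True
    have "(2::ennreal) / ennreal (b - a) \<noteq> \<infinity>" using ab by (simp add: ennreal_divide_eq_top_iff)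
    then have "v / A \<noteq> \<infinity>" using that(1) by (metis infinity_ennreal_def neq_top_trans)
    then have "v = 0" using True by (auto split: if_splits)
    then show ?thesis by simp
  next
    case False
    have "v = v / A * A" using False that(2) by (simp add: ennreal_divide_times)
    also have "\<dots> \<le> 2 / ennreal (b - a) * A" using that(1) by (rule mult_right_mono) simp
    finally show ?thesis by (simp add: ennreal_divide_times ennreal_times_divide mult.commute)
  qed
  have "g x / K \<le> 2 / ennreal (b - a)" "h x / L \<le> 2 / ennreal (b - a)"
    using x(2) by (auto intro: order_trans[OF _ x(2)])
  then show ?thesis using x(1) unnormalize KL by blast
qed

text \<open>On a subinterval shorter than \<open>a\<close>, some point \<open>z\<close> has \<open>\<phi> y = \<phi> z\<close> for almost every \<open>y\<close>, and
  by continuity for every \<open>y\<close>.  Thus \<open>\<phi>\<close> is locally constant on a connected set.  This disposes of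
  moduli \<open>p\<close> that vanish on a neighbourhood of 0, for which the chain of points below need not
  converge to the end of the interval.\<close>

lemma AE_local_eq_imp_const:
  fixes \<phi> :: "real \<Rightarrow> 'b::real_normed_vector"
  assumes cont: "continuous_on UNIV \<phi>" and a: "0 < a"
    and AE: "AE x in lborel. AE y in lborel.
      x \<in> {c..d} \<longrightarrow> y \<in> {c..d} \<longrightarrow> \<bar>x - y\<bar> \<le> a \<longrightarrow> \<phi> x = \<phi> y"
    and x: "x \<in> {c..d}" and y: "y \<in> {c..d}"
  shows "\<phi> x = \<phi> y"
proof (cases "c < d")
  case False
  then have "x = y" using x y by auto
  then show ?thesis by simp
next
  case True
  have closed: "closed {z. \<phi> z = v}" for v
    using continuous_closed_vimage[OF closed_singleton[of v], of \<phi>] cont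
    by (simp add: vimage_def continuous_on_eq_continuous_at)
  have local: "eventually (\<lambda>v. \<phi> u = \<phi> v) (at u within {c<..<d})" if u: "u \<in> {c<..<d}" for u
  proof -
    define J where "J = {max c (u - a / 2)<..<min d (u + a / 2)}"
    have J: "open J" "u \<in> J" using u a by (auto simp: J_def)
    have "\<not> (AE z in lborel. z \<notin> J)"
    proof
      assume "AE z in lborel. z \<notin> J"
      then have "emeasure lborel J = 0" by (subst (asm) AE_iff_measurable[of J]) (auto simp: J_def)
      then show False using J(2) by (auto simp: J_def)
    qed
    have "\<exists>z\<in>J. AE y in lborel. z \<in> {c..d} \<longrightarrow> y \<in> {c..d} \<longrightarrow> \<bar>z - y\<bar> \<le> a \<longrightarrow> \<phi> z = \<phi> y"
    proof (rule ccontr)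
      assume none: "\<not> ?thesis"
      have "AE z in lborel. z \<notin> J"
        using AE by eventually_elim (use none in blast)
      with \<open>\<not> (AE z in lborel. z \<notin> J)\<close> show False ..
    qed
    then obtain z where z: "z \<in> J"
      "AE y in lborel. z \<in> {c..d} \<longrightarrow> y \<in> {c..d} \<longrightarrow> \<bar>z - y\<bar> \<le> a \<longrightarrow> \<phi> z = \<phi> y"
      by blast
    have "AE y\<in>J in lborel. y \<in> {y. \<phi> y = \<phi> z}"
      using z(2)
    proof eventually_elim
      case (elim y)
      then show ?case using z(1) by (auto simp: J_def)
    qed
    then have "AE y\<in>J in lebesgue. y \<in> {y. \<phi> y = \<phi> z}"
      by (rule AE_completion)
    then have "v \<in> {y. \<phi> y = \<phi> z}" if "v \<in> J" for v
      using that by (intro mem_closed_if_AE_lebesgue_open[OF J(1) closed]) 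
    then have "\<forall>v\<in>J. \<phi> u = \<phi> v" using J(2) by auto
    then show ?thesis using J unfolding eventually_at_topological by blast
  qed
  define m where "m = (c + d) / 2"
  have m: "m \<in> {c<..<d}" using True by (auto simp: m_def)
  have "{c<..<d} \<subseteq> {z. \<phi> z = \<phi> m}"
    using connected_local_const[of "{c<..<d}" _ m \<phi>, OF connected_Ioo _ m] local by blast
  then have "closure {c<..<d} \<subseteq> {z. \<phi> z = \<phi> m}"
    by (rule closure_minimal[OF _ closed])
  then show ?thesis using x y True by (auto simp: subset_iff)
qed

section \<open>The one-dimensional inequality\<close>

lemma emeasure_Ioc_continuous:
  assumes "mono q" "continuous_on UNIV q" "a \<le> b"
  shows "emeasure (interval_measure q) {a<..b} = ennreal (q b - q a)"
proof (rule emeasure_interval_measure_Ioc[OF assms(3)])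
  show "q x \<le> q y" if "x \<le> y" for x y using assms(1) that by (rule monoD)
  show "continuous (at_right x) q" for x
    using assms(2) by (simp add: continuous_on_eq_continuous_at continuous_at_imp_continuous_at_within)
qed

lemma exists_half_value:
  fixes q :: "real \<Rightarrow> real"
  assumes "mono q" "continuous_on UNIV q" "q 0 = 0" "0 < q t" "0 < t"
  shows "\<exists>d. 0 < d \<and> d \<le> t \<and> q d = q t / 2"
proof -
  have "\<exists>d\<ge>0. d \<le> t \<and> q d = q t / 2"
    by (rule IVT') (use assms in \<open>auto intro: continuous_on_subset\<close>)
  then obtain d where d: "0 \<le> d" "d \<le> t" "q d = q t / 2" by auto
  moreover have "d \<noteq> 0" using d(3) assms by auto
  ultimately show ?thesis by (intro exI[of _ d]) auto
qed

lemma mono_integrand_measurable: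
  fixes G :: "ennreal \<Rightarrow> ennreal"
  assumes "mono G"
  shows "(\<lambda>u. G (B / ennreal (u\<^sup>2))) \<in> borel_measurable borel"
proof -
  note [measurable] = borel_measurable_mono_ennreal[OF assms]
  show ?thesis by measurable
qed

text \<open>The chain argument of Garsia, Rodemich and Rumsey.  With \<open>I x = \<integral> c x y dy\<close>, one chooses
  points \<open>t\<^sub>0 \<ge> d\<^sub>0 > t\<^sub>1 \<ge> d\<^sub>1 > \<dots>\<close> such that \<open>q d\<^sub>n = q t\<^sub>n / 2\<close>, and such that
  \<open>I t\<^sub>n\<^sub>+\<^sub>1\<close> and \<open>c t\<^sub>n t\<^sub>n\<^sub>+\<^sub>1\<close> are at most twice the averages over \<open>(0, d\<^sub>n)\<close> of \<open>I\<close> and \<open>c t\<^sub>n\<close>.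
  Then \<open>c t\<^sub>n t\<^sub>n\<^sub>+\<^sub>1 \<le> 2 I t\<^sub>n / d\<^sub>n \<le> 4B / d\<^sub>n\<^sup>2\<close>, while
  \<open>q (t\<^sub>n - t\<^sub>n\<^sub>+\<^sub>1) \<le> q t\<^sub>n = 2 q d\<^sub>n \<le> 4 (q d\<^sub>n - q d\<^sub>n\<^sub>+\<^sub>1)\<close>, because \<open>q d\<^sub>n\<^sub>+\<^sub>1 \<le> q d\<^sub>n / 2\<close>.  The
  \<open>n\<close>-th increment of \<open>\<phi>\<close> is therefore at most four times the integral of \<open>G (4B / u\<^sup>2)\<close> over
  \<open>(d\<^sub>n\<^sub>+\<^sub>1, d\<^sub>n]\<close>.  These intervals are disjoint, and \<open>t\<^sub>n\<close> tends to 0 since \<open>q t\<^sub>n\<close> does and \<open>q\<close> is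
  positive away from 0.\<close>

lemma chain_bound:
  fixes \<phi> :: "real \<Rightarrow> 'b::real_normed_vector"
  assumes phi: "continuous_on UNIV \<phi>"
    and q: "mono q" "continuous_on UNIV q" "q 0 = 0" and q_pos: "\<And>u. 0 < u \<Longrightarrow> 0 < q u"
    and G: "mono G"
    and c[measurable]: "case_prod c \<in> borel_measurable (lborel \<Otimes>\<^sub>M lborel)"
    and int: "(\<integral>\<^sup>+x. \<integral>\<^sup>+y. c x y \<partial>lborel \<partial>lborel) \<le> B" and B: "B < \<infinity>"
    and inc: "\<And>x y. \<lbrakk>x \<in> {0..l}; y \<in> {0..l}; c x y < \<infinity>\<rbrakk> \<Longrightarrow>
        ennreal (norm (\<phi> x - \<phi> y)) \<le> ennreal (q \<bar>x - y\<bar>) * G (c x y)"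
    and t0: "0 < t0" "t0 \<le> l" and start: "(\<integral>\<^sup>+y. c t0 y \<partial>lborel) \<le> 2 * B / ennreal l"
  shows "ennreal (norm (\<phi> t0 - \<phi> 0)) \<le>
    4 * (\<integral>\<^sup>+u\<in>{0..l}. G (4 * B / ennreal (u\<^sup>2)) \<partial>interval_measure q)"
proof -
  obtain \<beta> where \<beta>: "B = ennreal \<beta>" "0 \<le> \<beta>" using B by (cases B) auto
  let ?m = "interval_measure q"
  define I where "I x = (\<integral>\<^sup>+y. c x y \<partial>lborel)" for x
  have I[measurable]: "I \<in> borel_measurable borel" unfolding I_def by measurable
  have c1: "c x \<in> borel_measurable borel" for x
    using measurable_compose_Pair1[of x lborel "case_prod c" lborel borel] c by simp
  define h where "h u = G (4 * B / ennreal (u\<^sup>2))" for u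
  have [measurable]: "h \<in> borel_measurable borel"
    unfolding h_def by (rule mono_integrand_measurable[OF G])
  have twice: "2 * B / ennreal x = ennreal (2 * \<beta> / x)" if "0 < x" for x
    using that \<beta> by (simp add: divide_ennreal flip: ennreal_numeral ennreal_mult')
  have four: "4 * B / ennreal (x\<^sup>2) = ennreal (4 * \<beta> / x\<^sup>2)" if "0 < x" for x
    using that \<beta> by (simp add: divide_ennreal flip: ennreal_numeral ennreal_mult')
  have twice_mono: "2 * B / ennreal y \<le> 2 * B / ennreal x" if "0 < x" "x \<le> y" for x y
    using that \<beta>(2) by (auto simp: twice intro!: ennreal_leI divide_left_mono mult_pos_pos)
  \<comment> \<open>The state of the chain is a pair \<open>(t\<^sub>n, d\<^sub>n)\<close>; \<open>P\<close> is the invariant, \<open>Q\<close> links consecutive states.\<close>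
  define P where "P = (\<lambda>(t, d). 0 < d \<and> d \<le> t \<and> t \<le> l \<and> q d = q t / 2 \<and> I t \<le> 2 * B / ennreal d)"
  define Q where "Q = (\<lambda>(t, d) (t', d'::real). t' < d \<and> c t t' \<le> 4 * B / ennreal (d\<^sup>2))"
  have "\<exists>X. \<forall>n. (P (X n) \<and> (n = 0 \<longrightarrow> fst (X n) = t0)) \<and> Q (X n) (X (Suc n))"
  proof (rule dependent_nat_choice)
    obtain d where d: "0 < d" "d \<le> t0" "q d = q t0 / 2"
      using exists_half_value[OF q q_pos] t0 by blast
    have "I t0 \<le> 2 * B / ennreal d"
      using start twice_mono[of d l] d t0 by (auto simp: I_def)
    then show "\<exists>X. P X \<and> ((0::nat) = 0 \<longrightarrow> fst X = t0)" using d t0 by (intro exI[of _ "(t0, d)"]) (simp add: P_def)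
  next
    fix X and n :: nat assume "P X \<and> (n = 0 \<longrightarrow> fst X = t0)"
    then obtain t d where X: "X = (t, d)" "0 < d" "d \<le> t" "t \<le> l" "I t \<le> 2 * B / ennreal d"
      by (cases X) (auto simp: P_def)
    have "I t < \<infinity>" using X(5) unfolding twice[OF X(2)] by (auto simp: le_less_trans)
    then obtain t' where t': "0 < t'" "t' < d" "I t' \<le> 2 * B / ennreal d" "c t t' \<le> 2 * I t / ennreal d"
      using exists_le_twice_average2[of I "c t" B "I t" 0 d] c1[of t] int B X(2) by (auto simp: I_def)
    obtain d' where d': "0 < d'" "d' \<le> t'" "q d' = q t' / 2"
      using exists_half_value[OF q q_pos] t'(1) by blast
    have "2 * I t / ennreal d \<le> 2 * (2 * B / ennreal d) / ennreal d"
      using X(5) by (intro divide_right_mono_ennreal mult_left_mono) auto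
    also have "\<dots> = 4 * B / ennreal (d\<^sup>2)"
      using X(2) \<beta>(2) unfolding four[OF X(2)] twice[OF X(2)]
      by (simp add: divide_ennreal power2_eq_square flip: ennreal_numeral ennreal_mult')
    finally have "c t t' \<le> 4 * B / ennreal (d\<^sup>2)" using t'(4) by (rule order_trans[rotated])
    moreover have "I t' \<le> 2 * B / ennreal d'"
      using t'(3) twice_mono[of d' d] d' t'(2) by auto
    ultimately show "\<exists>Y. (P Y \<and> (Suc n = 0 \<longrightarrow> fst Y = t0)) \<and> Q X Y"
      using t' d' X by (intro exI[of _ "(t', d')"]) (auto simp: P_def Q_def)
  qed
  then obtain X where X: "\<And>n. P (X n)" "\<And>n. Q (X n) (X (Suc n))" "fst (X 0) = t0" by blast
  define T where "T n = fst (X n)" for n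
  define D where "D n = snd (X n)" for n
  have chain: "0 < D n" "D n \<le> T n" "T n \<le> l" "q (D n) = q (T n) / 2"
      "T (Suc n) < D n" "c (T n) (T (Suc n)) \<le> 4 * B / ennreal ((D n)\<^sup>2)" for n
    using X(1,2)[of n] by (auto simp: P_def Q_def T_def D_def split: prod.splits)
  have T0: "T 0 = t0" using X(3) by (simp add: T_def)
  note q_mono = monoD[OF q(1)]
  have step: "ennreal (norm (\<phi> (T n) - \<phi> (T (Suc n)))) \<le> 4 * (\<integral>\<^sup>+u\<in>{D (Suc n)<..D n}. h u \<partial>?m)" for n
  proof -
    have T: "0 < T n" "0 < T (Suc n)" using chain[of n] chain[of "Suc n"] by linarith+
    have D: "D (Suc n) \<le> D n" using chain[of n] chain[of "Suc n"] by linarith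
    have "4 * B / ennreal ((D n)\<^sup>2) < \<infinity>" using four[OF chain(1)] by simp
    then have "c (T n) (T (Suc n)) < \<infinity>" using chain(6) by (rule le_less_trans[rotated])
    then have "ennreal (norm (\<phi> (T n) - \<phi> (T (Suc n)))) \<le>
        ennreal (q \<bar>T n - T (Suc n)\<bar>) * G (c (T n) (T (Suc n)))"
      using T chain(3)[of n] chain(3)[of "Suc n"] by (intro inc) auto
    also have "\<dots> \<le> ennreal (4 * (q (D n) - q (D (Suc n)))) * h (D n)"
    proof (rule mult_mono)
      have "q \<bar>T n - T (Suc n)\<bar> \<le> q (T n)"
        using T chain[of n] by (intro q_mono) auto
      also have "\<dots> = 2 * q (D n)" using chain(4)[of n] by simp
      also have "\<dots> \<le> 4 * (q (D n) - q (D (Suc n)))"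
        using chain(4)[of "Suc n"] q_mono[of "T (Suc n)" "D n"] chain(5)[of n] by simp
      finally show "ennreal (q \<bar>T n - T (Suc n)\<bar>) \<le> ennreal (4 * (q (D n) - q (D (Suc n))))"
        by (rule ennreal_leI)
      show "G (c (T n) (T (Suc n))) \<le> h (D n)"
        unfolding h_def by (rule monoD[OF G chain(6)])
    qed auto
    also have "\<dots> = 4 * (\<integral>\<^sup>+u. h (D n) * indicator {D (Suc n)<..D n} u \<partial>?m)"
      using q_mono[OF D] D
      by (subst nn_integral_cmult_indicator)
         (simp_all add: emeasure_Ioc_continuous[OF q(1,2)] ennreal_mult mult_ac del: right_diff_distrib_numeral)
    also have "\<dots> \<le> 4 * (\<integral>\<^sup>+u\<in>{D (Suc n)<..D n}. h u \<partial>?m)"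
    proof (intro mult_left_mono nn_integral_mono)
      fix u
      show "h (D n) * indicator {D (Suc n)<..D n} u \<le> h u * indicator {D (Suc n)<..D n} u"
      proof (cases "u \<in> {D (Suc n)<..D n}")
        case True
        then have u: "0 < u" "u \<le> D n" using chain(1)[of "Suc n"] by auto
        have "4 * B / ennreal ((D n)\<^sup>2) \<le> 4 * B / ennreal (u\<^sup>2)"
          using u chain(1)[of n] \<beta>(2) unfolding four[OF u(1)] four[OF chain(1)]
          by (intro ennreal_leI divide_left_mono power_mono mult_pos_pos) auto
        then show ?thesis using True by (auto simp: h_def intro: monoD[OF G])
      qed auto
    qed auto
    finally show ?thesis .
  qed
  \<comment> \<open>Telescoping: the intervals \<open>(D (n + 1), D n]\<close> fit together to \<open>(D n, D 0]\<close>.\<close>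
  have partial: "D n \<le> D 0 \<and> ennreal (norm (\<phi> (T 0) - \<phi> (T n))) \<le> 4 * (\<integral>\<^sup>+u\<in>{D n<..D 0}. h u \<partial>?m)" for n
  proof (induction n)
    case 0
    show ?case by simp
  next
    case (Suc n)
    have D: "D (Suc n) \<le> D n" using chain[of n] chain[of "Suc n"] by linarith
    have "norm (\<phi> (T 0) - \<phi> (T (Suc n))) \<le> norm (\<phi> (T 0) - \<phi> (T n)) + norm (\<phi> (T n) - \<phi> (T (Suc n)))"
      using norm_triangle_ineq[of "\<phi> (T 0) - \<phi> (T n)" "\<phi> (T n) - \<phi> (T (Suc n))"] by simp
    then have "ennreal (norm (\<phi> (T 0) - \<phi> (T (Suc n)))) \<le>
        ennreal (norm (\<phi> (T 0) - \<phi> (T n))) + ennreal (norm (\<phi> (T n) - \<phi> (T (Suc n))))"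
      by (simp flip: ennreal_plus)
    also have "\<dots> \<le> 4 * (\<integral>\<^sup>+u\<in>{D n<..D 0}. h u \<partial>?m) + 4 * (\<integral>\<^sup>+u\<in>{D (Suc n)<..D n}. h u \<partial>?m)"
      using Suc.IH step[of n] by (intro add_mono) auto
    also have "\<dots> = 4 * (\<integral>\<^sup>+u. h u * indicator {D n<..D 0} u + h u * indicator {D (Suc n)<..D n} u \<partial>?m)"
      by (subst nn_integral_add) (auto simp: distrib_left)
    also have "\<dots> = 4 * (\<integral>\<^sup>+u\<in>{D (Suc n)<..D 0}. h u \<partial>?m)"
      using Suc.IH D by (intro arg_cong2[where f="(*)"] refl nn_integral_cong) (auto simp: indicator_def)
    finally show ?case using Suc.IH D by auto
  qed
  have "T \<longlonglongrightarrow> 0"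
  proof (rule LIMSEQ_I)
    fix r :: real assume r: "0 < r"
    have qT: "q (T n) \<le> q (T 0) * (1/2) ^ n" for n
    proof (induction n)
      case (Suc n)
      have "q (T (Suc n)) \<le> q (D n)" using chain(5)[of n] by (intro q_mono) auto
      then show ?case using Suc.IH chain(4)[of n] by simp
    qed simp
    have "(\<lambda>n. q (T 0) * (1/2) ^ n) \<longlonglongrightarrow> q (T 0) * 0"
      by (intro tendsto_intros LIMSEQ_power_zero) auto
    then have "eventually (\<lambda>n. q (T 0) * (1/2) ^ n < q r) sequentially"
      using q_pos[OF r] by (intro order_tendstoD(2)[of _ 0]) auto
    then obtain N where N: "\<And>n. n \<ge> N \<Longrightarrow> q (T 0) * (1/2) ^ n < q r"
      by (auto simp: eventually_sequentially)
    have "norm (T n - 0) < r" if "n \<ge> N" for n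
    proof -
      have "T n < r" using q_mono[of r "T n"] qT[of n] N[OF that] by (meson not_le order_trans)
      then show ?thesis using chain(1,2)[of n] by auto
    qed
    then show "\<exists>N. \<forall>n\<ge>N. norm (T n - 0) < r" by blast
  qed
  moreover have "isCont \<phi> 0" using phi by (simp add: continuous_on_eq_continuous_at)
  ultimately have "(\<lambda>n. \<phi> (T n)) \<longlonglongrightarrow> \<phi> 0" by (rule isCont_tendsto_compose[rotated])
  then have lim: "(\<lambda>n. ennreal (norm (\<phi> (T 0) - \<phi> (T n)))) \<longlonglongrightarrow> ennreal (norm (\<phi> (T 0) - \<phi> 0))"
    by (intro tendsto_intros)
  have "ennreal (norm (\<phi> (T 0) - \<phi> (T n))) \<le> 4 * (\<integral>\<^sup>+u\<in>{0..l}. h u \<partial>?m)" for n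
  proof -
    have "(\<integral>\<^sup>+u\<in>{D n<..D 0}. h u \<partial>?m) \<le> (\<integral>\<^sup>+u\<in>{0..l}. h u \<partial>?m)"
      using chain(1)[of n] chain(2,3)[of 0]
      by (intro nn_integral_mono) (auto simp: indicator_def)
    then show ?thesis using partial[of n] by (meson mult_left_mono order_trans zero_le)
  qed
  then have "ennreal (norm (\<phi> (T 0) - \<phi> 0)) \<le> 4 * (\<integral>\<^sup>+u\<in>{0..l}. h u \<partial>?m)"
    by (intro LIMSEQ_le_const2[OF lim]) auto
  then show ?thesis using T0 by (simp add: h_def)
qed

text \<open>The chain may run to either end of the interval: the map \<open>u \<mapsto> r + \<sigma> u\<close> moves the end \<open>r\<close> to 0
  and preserves distances and Lebesgue measure.\<close>

lemma chain_bound_oriented: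
  fixes \<phi> :: "real \<Rightarrow> 'b::real_normed_vector" and \<sigma> :: real
  assumes phi: "continuous_on UNIV \<phi>"
    and q: "mono q" "continuous_on UNIV q" "q 0 = 0" and q_pos: "\<And>u. 0 < u \<Longrightarrow> 0 < q u"
    and G: "mono G"
    and c[measurable]: "case_prod c \<in> borel_measurable (lborel \<Otimes>\<^sub>M lborel)"
    and int: "(\<integral>\<^sup>+x. \<integral>\<^sup>+y. c x y \<partial>lborel \<partial>lborel) \<le> B" and B: "B < \<infinity>"
    and inc: "\<And>x y. \<lbrakk>x \<in> {s..t}; y \<in> {s..t}; c x y < \<infinity>\<rbrakk> \<Longrightarrow>
        ennreal (norm (\<phi> x - \<phi> y)) \<le> ennreal (q \<bar>x - y\<bar>) * G (c x y)"
    and t0: "t0 \<in> {s<..<t}" and start: "(\<integral>\<^sup>+y. c t0 y \<partial>lborel) \<le> 2 * B / ennreal (t - s)"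
    and r: "r = s \<and> \<sigma> = 1 \<or> r = t \<and> \<sigma> = - 1"
  shows "ennreal (norm (\<phi> t0 - \<phi> r)) \<le>
    4 * (\<integral>\<^sup>+u\<in>{0..t - s}. G (4 * B / ennreal (u\<^sup>2)) \<partial>interval_measure q)"
proof -
  have s: "\<sigma> \<noteq> 0" "\<bar>\<sigma>\<bar> = 1" "\<sigma> * \<sigma> = 1" using r by auto
  have inverse: "r + \<sigma> * (\<sigma> * (x - r)) = x" for x using s(3) by (simp flip: mult.assoc)
  let ?c = "\<lambda>u v. c (r + \<sigma> * u) (r + \<sigma> * v)"
  have c1: "c x \<in> borel_measurable borel" for x
    using measurable_compose_Pair1[of x lborel "case_prod c" lborel borel] c by simp
  have I: "(\<lambda>x. \<integral>\<^sup>+y. c x y \<partial>lborel) \<in> borel_measurable borel" by measurable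
  have inner: "(\<integral>\<^sup>+v. c x (r + \<sigma> * v) \<partial>lborel) = (\<integral>\<^sup>+y. c x y \<partial>lborel)" for x
    using nn_integral_real_affine[OF c1, of \<sigma> x r] s by simp
  have "ennreal (norm (\<phi> (r + \<sigma> * (\<sigma> * (t0 - r))) - \<phi> (r + \<sigma> * 0))) \<le>
    4 * (\<integral>\<^sup>+u\<in>{0..t - s}. G (4 * B / ennreal (u\<^sup>2)) \<partial>interval_measure q)"
  proof (rule chain_bound[where c = ?c, OF _ q q_pos G])
    show "continuous_on UNIV (\<lambda>u. \<phi> (r + \<sigma> * u))"
      by (intro continuous_on_compose2[OF phi] continuous_intros) auto
    show "case_prod ?c \<in> borel_measurable (lborel \<Otimes>\<^sub>M lborel)" by measurable
    show "(\<integral>\<^sup>+u. \<integral>\<^sup>+v. ?c u v \<partial>lborel \<partial>lborel) \<le> B"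
      using int nn_integral_real_affine[OF I s(1), of r] s(2) by (simp add: inner)
    show "B < \<infinity>" by fact
    show "0 < \<sigma> * (t0 - r)" "\<sigma> * (t0 - r) \<le> t - s" using t0 r by auto
    show "(\<integral>\<^sup>+v. ?c (\<sigma> * (t0 - r)) v \<partial>lborel) \<le> 2 * B / ennreal (t - s)"
      using start by (simp add: inner inverse)
    fix u v assume uv: "u \<in> {0..t - s}" "v \<in> {0..t - s}" "?c u v < \<infinity>"
    have "\<bar>(r + \<sigma> * u) - (r + \<sigma> * v)\<bar> = \<bar>u - v\<bar>" using r by auto
    then show "ennreal (norm (\<phi> (r + \<sigma> * u) - \<phi> (r + \<sigma> * v))) \<le> ennreal (q \<bar>u - v\<bar>) * G (?c u v)"
      using inc[of "r + \<sigma> * u" "r + \<sigma> * v"] uv r by auto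
  qed
  then show ?thesis by (simp add: inverse)
qed

text \<open>Both ends are reached from a common starting point \<open>t0\<close>, at which \<open>\<integral> c t0 y dy\<close> is at most
  its average; the two halves, with constant 4 each, give the constant 8.\<close>

lemma increment_bound_1d_ordered:
  fixes \<phi> :: "real \<Rightarrow> 'b::real_normed_vector"
  assumes phi: "continuous_on UNIV \<phi>"
    and q: "mono q" "continuous_on UNIV q" "q 0 = 0"
    and G: "mono G"
    and c[measurable]: "case_prod c \<in> borel_measurable (lborel \<Otimes>\<^sub>M lborel)"
    and int: "(\<integral>\<^sup>+x. \<integral>\<^sup>+y. c x y \<partial>lborel \<partial>lborel) \<le> B" and B: "B < \<infinity>"
    and inc: "\<And>x y. \<lbrakk>x \<in> {s..t}; y \<in> {s..t}; c x y < \<infinity>\<rbrakk> \<Longrightarrow>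
        ennreal (norm (\<phi> x - \<phi> y)) \<le> ennreal (q \<bar>x - y\<bar>) * G (c x y)"
    and st: "s < t"
  shows "ennreal (norm (\<phi> s - \<phi> t)) \<le>
    8 * (\<integral>\<^sup>+u\<in>{0..t - s}. G (4 * B / ennreal (u\<^sup>2)) \<partial>interval_measure q)"
proof (cases "\<exists>a>0. q a \<le> 0")
  case True
  then obtain a where a: "0 < a" "q a \<le> 0" by blast
  have "AE x in lborel. (\<integral>\<^sup>+y. c x y \<partial>lborel) \<noteq> \<infinity>"
    using int B by (intro nn_integral_PInf_AE) (auto simp: top_unique)
  then have "AE x in lborel. AE y in lborel. c x y \<noteq> \<infinity>"
  proof eventually_elim
    case (elim x)
    have "c x \<in> borel_measurable lborel" by measurable
    then show ?case using elim by (rule nn_integral_PInf_AE)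
  qed
  then have "AE x in lborel. AE y in lborel.
      x \<in> {s..t} \<longrightarrow> y \<in> {s..t} \<longrightarrow> \<bar>x - y\<bar> \<le> a \<longrightarrow> \<phi> x = \<phi> y"
  proof eventually_elim
    case (elim x)
    then show ?case
    proof eventually_elim
      case xy: (elim y)
      show ?case
      proof (intro impI)
        assume x: "x \<in> {s..t}" and y: "y \<in> {s..t}" and le: "\<bar>x - y\<bar> \<le> a"
        have "q \<bar>x - y\<bar> \<le> 0" using monoD[OF q(1) le] a(2) by simp
        then have "ennreal (norm (\<phi> x - \<phi> y)) \<le> 0"
          using inc[OF x y] xy by (simp add: ennreal_neg top.not_eq_extremum)
        then show "\<phi> x = \<phi> y" by simp
      qed
    qed
  qed
  then have "\<phi> s = \<phi> t" using st by (intro AE_local_eq_imp_const[OF phi a(1)]) auto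
  then show ?thesis by simp
next
  case False
  then have q_pos: "0 < q u" if "0 < u" for u using that by force
  have "\<exists>x\<in>{s<..<t}. (\<integral>\<^sup>+y. c x y \<partial>lborel) \<le> B / ennreal (t - s)"
    using int B st by (intro exists_le_average) auto
  then obtain t0 where t0: "t0 \<in> {s<..<t}" "(\<integral>\<^sup>+y. c t0 y \<partial>lborel) \<le> B / ennreal (t - s)"
    by blast
  have "B \<le> 2 * B" by (simp add: mult_2)
  then have start: "(\<integral>\<^sup>+y. c t0 y \<partial>lborel) \<le> 2 * B / ennreal (t - s)"
    by (rule order_trans[OF t0(2) divide_right_mono_ennreal])
  note half = chain_bound_oriented[OF phi q q_pos G c int B inc t0(1) start]
  have "norm (\<phi> s - \<phi> t) \<le> norm (\<phi> t0 - \<phi> s) + norm (\<phi> t0 - \<phi> t)"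
    using norm_triangle_ineq4[of "\<phi> t0 - \<phi> t" "\<phi> t0 - \<phi> s"] by (simp add: norm_minus_commute add.commute)
  then have "ennreal (norm (\<phi> s - \<phi> t)) \<le> ennreal (norm (\<phi> t0 - \<phi> s)) + ennreal (norm (\<phi> t0 - \<phi> t))"
    by (simp flip: ennreal_plus)
  also have "\<dots> \<le> 4 * (\<integral>\<^sup>+u\<in>{0..t - s}. G (4 * B / ennreal (u\<^sup>2)) \<partial>interval_measure q) +
      4 * (\<integral>\<^sup>+u\<in>{0..t - s}. G (4 * B / ennreal (u\<^sup>2)) \<partial>interval_measure q)"
    by (intro add_mono half) auto
  finally show ?thesis by (simp flip: distrib_right)
qed

text \<open>The hypothesis \<open>inc\<close> speaks only of points with \<open>c x y < \<infinity>\<close>: an infinite value may come from a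
  quotient \<open>a / 0\<close> with \<open>a > 0\<close>, where the product on the right is 0 and the inequality fails.\<close>

lemma increment_bound_1d:
  fixes \<phi> :: "real \<Rightarrow> 'b::real_normed_vector"
  assumes phi: "continuous_on UNIV \<phi>"
    and q: "mono q" "continuous_on UNIV q" "q 0 = 0"
    and G: "mono G"
    and c: "case_prod c \<in> borel_measurable (lborel \<Otimes>\<^sub>M lborel)"
    and int: "(\<integral>\<^sup>+x. \<integral>\<^sup>+y. c x y \<partial>lborel \<partial>lborel) \<le> B" and B: "B < \<infinity>"
    and inc: "\<And>x y. \<lbrakk>x \<in> {a..b}; y \<in> {a..b}; c x y < \<infinity>\<rbrakk> \<Longrightarrow>
        ennreal (norm (\<phi> x - \<phi> y)) \<le> ennreal (q \<bar>x - y\<bar>) * G (c x y)"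
    and st: "s \<in> {a..b}" "t \<in> {a..b}"
  shows "ennreal (norm (\<phi> s - \<phi> t)) \<le>
    8 * (\<integral>\<^sup>+u\<in>{0..\<bar>s - t\<bar>}. G (4 * B / ennreal (u\<^sup>2)) \<partial>interval_measure q)"
proof -
  note ordered = increment_bound_1d_ordered[OF phi q G c int B inc]
  consider "s = t" | "s < t" | "t < s" by linarith
  then show ?thesis
  proof cases
    case 2
    then show ?thesis using st ordered[of s t] by (auto simp: abs_minus_commute)
  next
    case 3
    then show ?thesis using st ordered[of t s] by (auto simp: norm_minus_commute)
  qed simp
qed

section \<open>Rectangular increments over a subset of the coordinates\<close>

text \<open>Restricting the operator product to the coordinates in \<open>A\<close> makes induction over the coordinates
  possible although the dimension is fixed by the type.\<close>

definition partial_increment ::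
    "'n::finite set \<Rightarrow> real ^ 'n \<Rightarrow> (real ^ 'n \<Rightarrow> 'b::ab_group_add) \<Rightarrow> real ^ 'n \<Rightarrow> 'b"
  where "partial_increment A y f = Finite_Set.fold (\<lambda>k. diff_op k y) f A"

lemma rect_increment_eq_partial: "rect_increment y f = partial_increment UNIV y f"
  by (simp add: rect_increment_def partial_increment_def)

lemma partial_increment_empty [simp]: "partial_increment {} y f = f"
  by (simp add: partial_increment_def)

lemma partial_increment_insert:
  assumes "k \<notin> A"
  shows "partial_increment (insert k A) y f x =
    partial_increment A y f x - partial_increment A y f (subst_coord k y x)"
proof -
  interpret comp_fun_commute "\<lambda>k. diff_op k y"
    by (rule comp_fun_commute_diff_op)
  show ?thesis
    using assms by (simp add: partial_increment_def fold_insert diff_op_def V_op_def)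
qed

lemma partial_increment_cong:
  fixes A :: "'n::finite set"
  assumes "\<And>k. k \<in> A \<Longrightarrow> y $ k = z $ k"
  shows "partial_increment A y f x = partial_increment A z f x"
  using finite[of A] assms
proof (induction A arbitrary: x rule: finite_induct)
  case (insert k A)
  have "subst_coord k y x = subst_coord k z x"
    using insert.prems by (simp add: subst_coord_def vec_eq_iff)
  then show ?case using insert by (simp add: partial_increment_insert)
qed simp

text \<open>Differencing \<open>f\<close> in coordinate \<open>k\<close> commutes with the increments in the other coordinates.\<close>

lemma partial_increment_diff_subst:
  fixes A :: "'n::finite set"
  assumes "k \<notin> A"
  shows "partial_increment A y (\<lambda>z. f (subst_coord k v z) - f (subst_coord k w z)) x =
    partial_increment A y f (subst_coord k v x) - partial_increment A y f (subst_coord k w x)"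
  using finite[of A] assms
proof (induction A arbitrary: x rule: finite_induct)
  case (insert j A)
  then have "subst_coord k u (subst_coord j y x) = subst_coord j y (subst_coord k u x)" for u
    by (auto simp: subst_coord_def vec_eq_iff)
  then show ?case using insert by (simp add: partial_increment_insert)
qed simp

lemma continuous_subst_coord:
  fixes g h :: "'a::topological_space \<Rightarrow> real ^ 'n::finite"
  assumes "continuous_on S g" "continuous_on S h"
  shows "continuous_on S (\<lambda>z. subst_coord k (g z) (h z))"
  unfolding subst_coord_def
proof (rule continuous_on_vec_lambda)
  show "continuous_on S (\<lambda>z. if i = k then g z $ i else h z $ i)" for i
    using assms by (cases "i = k") (auto intro: continuous_intros)
qed

lemma continuous_partial_increment:
  fixes A :: "'n::finite set" and f :: "real ^ 'n \<Rightarrow> 'b::real_normed_vector"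
    and g h :: "'a::topological_space \<Rightarrow> real ^ 'n"
  assumes "continuous_on UNIV f" "continuous_on S g" "continuous_on S h"
  shows "continuous_on S (\<lambda>z. partial_increment A (g z) f (h z))"
  using finite[of A] assms(3)
proof (induction A arbitrary: h rule: finite_induct)
  case empty
  then show ?case using continuous_on_compose2[OF assms(1), of S h] by simp
next
  case (insert k A)
  have "continuous_on S (\<lambda>z. partial_increment A (g z) f (h z))"
    "continuous_on S (\<lambda>z. partial_increment A (g z) f (subst_coord k (g z) (h z)))"
    using insert.prems by (auto intro!: insert.IH continuous_subst_coord assms)
  then show ?case using insert.hyps by (simp add: partial_increment_insert continuous_on_diff)
qed

lemma subst_coord_vec_lambda:
  "subst_coord k (vec_lambda y) (vec_lambda x) = vec_lambda (x(k := y k))"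
  by (simp add: subst_coord_def vec_eq_iff)

section \<open>Induction over the coordinates\<close>

text \<open>As a product, the indicator of a box is visibly measurable, and it splits off one coordinate
  in the induction step.\<close>

lemma indicator_Pi_eq_prod:
  assumes "finite A"
  shows "(indicator (Pi A S) u :: ennreal) = (\<Prod>k\<in>A. indicator (S k) (u k))"
  using assms by (induction A rule: finite_induct) (auto simp: indicator_def)

lemma product_sigma_finite_interval_measure:
  assumes "\<And>k. mono (q k)" "\<And>k. continuous_on UNIV (q k)"
  shows "product_sigma_finite (\<lambda>k. interval_measure (q k))"
proof (rule product_sigma_finite.intro)
  fix k
  show "sigma_finite_measure (interval_measure (q k))"
  proof (rule sigma_finite_interval_measure)
    show "q k x \<le> q k y" if "x \<le> y" for x y using assms(1) that by (rule monoD)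
    show "continuous (at_right x) (q k)" for x
      using assms(2)[of k] by (simp add: continuous_on_eq_continuous_at continuous_at_imp_continuous_at_within)
  qed
qed

text \<open>The coordinate \<open>k\<close> of both variables is moved to the two innermost integrals, as required for
  applying the one-dimensional inequality to it with the remaining coordinates fixed.\<close>

lemma nn_integral_fubini_insert2:
  fixes b :: "('n \<Rightarrow> real) \<Rightarrow> ('n \<Rightarrow> real) \<Rightarrow> ennreal"
  assumes A: "finite A" "k \<notin> A"
    and b[measurable]: "case_prod b \<in> borel_measurable
      (PiM (insert k A) (\<lambda>_. lborel) \<Otimes>\<^sub>M PiM (insert k A) (\<lambda>_. lborel))"
  shows "(\<integral>\<^sup>+x. \<integral>\<^sup>+y. b x y \<partial>PiM (insert k A) (\<lambda>_. lborel) \<partial>PiM (insert k A) (\<lambda>_. lborel)) =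
    (\<integral>\<^sup>+x. \<integral>\<^sup>+y. \<integral>\<^sup>+r. \<integral>\<^sup>+v. b (x(k := r)) (y(k := v)) \<partial>lborel \<partial>lborel
      \<partial>PiM A (\<lambda>_. lborel) \<partial>PiM A (\<lambda>_. lborel))"
proof -
  interpret L: product_sigma_finite "\<lambda>_::'n. lborel :: real measure" by standard
  interpret LA: finite_product_sigma_finite "\<lambda>_::'n. lborel :: real measure" A by standard fact
  interpret LkA: finite_product_sigma_finite "\<lambda>_::'n. lborel :: real measure" "insert k A"
    by standard (simp add: A)
  interpret P: pair_sigma_finite "lborel :: real measure" "PiM A (\<lambda>_. lborel :: real measure)" ..
  let ?L = "PiM A (\<lambda>_. lborel :: real measure)"
  have "(\<integral>\<^sup>+x. \<integral>\<^sup>+y. b x y \<partial>PiM (insert k A) (\<lambda>_. lborel) \<partial>PiM (insert k A) (\<lambda>_. lborel)) =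
      (\<integral>\<^sup>+x. \<integral>\<^sup>+r. \<integral>\<^sup>+y. b (x(k := r)) y \<partial>PiM (insert k A) (\<lambda>_. lborel) \<partial>lborel \<partial>?L)"
  proof (rule L.product_nn_integral_insert[OF A])
    show "(\<lambda>x. \<integral>\<^sup>+y. b x y \<partial>PiM (insert k A) (\<lambda>_. lborel)) \<in>
        borel_measurable (PiM (insert k A) (\<lambda>_. lborel))"
      by (rule LkA.borel_measurable_nn_integral[OF b])
  qed
  also have "\<dots> = (\<integral>\<^sup>+x. \<integral>\<^sup>+r. \<integral>\<^sup>+y. \<integral>\<^sup>+v. b (x(k := r)) (y(k := v)) \<partial>lborel \<partial>?L \<partial>lborel \<partial>?L)"
  proof (intro nn_integral_cong L.product_nn_integral_insert[OF A])
    fix x r assume [measurable]: "x \<in> space ?L"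
    have "x(k := r) \<in> space (PiM (insert k A) (\<lambda>_. lborel))"
      using \<open>x \<in> space ?L\<close> by (auto simp: space_PiM PiE_iff extensional_def)
    then show "b (x(k := r)) \<in> borel_measurable (PiM (insert k A) (\<lambda>_. lborel))"
      by measurable
  qed
  also have "\<dots> = (\<integral>\<^sup>+x. \<integral>\<^sup>+y. \<integral>\<^sup>+r. \<integral>\<^sup>+v. b (x(k := r)) (y(k := v)) \<partial>lborel \<partial>lborel \<partial>?L \<partial>?L)"
  proof (intro nn_integral_cong P.Fubini'[symmetric])
    fix x assume [measurable]: "x \<in> space ?L"
    show "(\<lambda>(r, y). \<integral>\<^sup>+v. b (x(k := r)) (y(k := v)) \<partial>lborel) \<in> borel_measurable (lborel \<Otimes>\<^sub>M ?L)"
      by measurable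
  qed
  finally show ?thesis .
qed

text \<open>The inequality for a general monotone \<open>G\<close> and a general weight \<open>b\<close>.  Both, together with \<open>f\<close>,
  must be arbitrary in the induction, since the step replaces all three.  The points are functions
  that are extensional on \<open>A\<close>, so that they range over the space of the product measure; outside
  \<open>A\<close>, the arguments of \<open>f\<close> then have default coordinates.\<close>

lemma partial_increment_bound:
  fixes f :: "real ^ 'n::finite \<Rightarrow> 'b::real_normed_vector" and q :: "'n \<Rightarrow> real \<Rightarrow> real"
    and A :: "'n set"
  assumes q: "\<And>k. mono (q k)" "\<And>k. continuous_on UNIV (q k)" "\<And>k. q k 0 = 0"
    and f: "continuous_on UNIV f" and G: "mono G"
    and b: "case_prod b \<in> borel_measurable (PiM A (\<lambda>_. lborel) \<Otimes>\<^sub>M PiM A (\<lambda>_. lborel))"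
    and int: "(\<integral>\<^sup>+x. \<integral>\<^sup>+y. b x y \<partial>PiM A (\<lambda>_. lborel) \<partial>PiM A (\<lambda>_. lborel)) \<le> B"
    and B: "B < \<infinity>"
    and inc: "\<And>x y. \<lbrakk>x \<in> A \<rightarrow>\<^sub>E {0..1}; y \<in> A \<rightarrow>\<^sub>E {0..1}; b x y < \<infinity>\<rbrakk> \<Longrightarrow>
        ennreal (norm (partial_increment A (vec_lambda y) f (vec_lambda x))) \<le>
          ennreal (\<Prod>k\<in>A. q k \<bar>x k - y k\<bar>) * G (b x y)"
    and s: "s \<in> A \<rightarrow>\<^sub>E {0..1}" and t: "t \<in> A \<rightarrow>\<^sub>E {0..1}"
  shows "ennreal (norm (partial_increment A (vec_lambda s) f (vec_lambda t))) \<le>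
    8 ^ card A * (\<integral>\<^sup>+u\<in>(\<Pi> k\<in>A. {0..\<bar>s k - t k\<bar>}).
      G (4 ^ card A * B / (\<Prod>k\<in>A. ennreal ((u k)\<^sup>2))) \<partial>PiM A (\<lambda>k. interval_measure (q k)))"
  using finite[of A] f G b int B inc s t
proof (induction A arbitrary: f G b B s t rule: finite_induct)
  case empty
  interpret L: product_sigma_finite "\<lambda>_::'n. lborel :: real measure" by standard
  interpret M: product_sigma_finite "\<lambda>k. interval_measure (q k)"
    by (rule product_sigma_finite_interval_measure[OF q(1,2)])
  let ?u = "\<lambda>_::'n. undefined :: real"
  have b: "b ?u ?u \<le> B" using empty.prems(4) by (simp add: L.nn_integral_empty)
  then have "b ?u ?u < \<infinity>" using empty.prems(5) by (rule le_less_trans)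
  then have "ennreal (norm (f (vec_lambda ?u))) \<le> G (b ?u ?u)"
    using empty.prems(6)[of ?u ?u] by simp
  also have "\<dots> \<le> G B" using empty.prems(2) b by (rule monoD)
  finally show ?case using empty.prems(7,8) by (simp add: PiM_empty divide_ennreal_def)
next
  case (insert k A)
  let ?L = "\<lambda>_::'n. lborel :: real measure"
  let ?m = "\<lambda>k. interval_measure (q k)"
  interpret L: product_sigma_finite ?L by standard
  interpret M: product_sigma_finite ?m
    by (rule product_sigma_finite_interval_measure[OF q(1,2)])
  note f = insert.prems(1) and G = insert.prems(2) and b = insert.prems(3)
  note [measurable] = b borel_measurable_mono_ennreal[OF G]
  define J where "J = {0..\<bar>s k - t k\<bar>}"
  define G' where "G' v = 8 * (\<integral>\<^sup>+r\<in>J. G (4 * v / ennreal (r\<^sup>2)) \<partial>?m k)" for v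
  define b' where "b' x y = (\<integral>\<^sup>+r. \<integral>\<^sup>+v. b (x(k := r)) (y(k := v)) \<partial>lborel \<partial>lborel)" for x y
  define f' where "f' z = f (subst_coord k (vec_lambda t) z) - f (subst_coord k (vec_lambda s) z)" for z
  define s' where "s' = restrict s A"
  define t' where "t' = restrict t A"
  have st: "s k \<in> {0..1}" "t k \<in> {0..1}" using insert.prems(7,8) by auto
  \<comment> \<open>The condition on \<open>f\<close>, \<open>b\<close>, \<open>G\<close> over \<open>insert k A\<close> yields the same condition on \<open>f'\<close>, \<open>b'\<close>, \<open>G'\<close> over \<open>A\<close>.\<close>
  have IH: "ennreal (norm (partial_increment A (vec_lambda s') f' (vec_lambda t'))) \<le>
    8 ^ card A * (\<integral>\<^sup>+u\<in>(\<Pi> k\<in>A. {0..\<bar>s' k - t' k\<bar>}).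
      G' (4 ^ card A * B / (\<Prod>k\<in>A. ennreal ((u k)\<^sup>2))) \<partial>PiM A ?m)"
  proof (rule insert.IH)
    show "continuous_on UNIV f'"
      unfolding f'_def
      by (intro continuous_intros continuous_on_compose2[OF f] continuous_subst_coord) auto
    show "mono G'"
      unfolding G'_def
      by (intro monoI mult_left_mono nn_integral_mono mult_right_mono monoD[OF G] divide_right_mono_ennreal) auto
    show "case_prod b' \<in> borel_measurable (PiM A ?L \<Otimes>\<^sub>M PiM A ?L)"
      unfolding b'_def by measurable
    show "(\<integral>\<^sup>+x. \<integral>\<^sup>+y. b' x y \<partial>PiM A ?L \<partial>PiM A ?L) \<le> B"
      using insert.prems(4) unfolding b'_def nn_integral_fubini_insert2[OF insert.hyps b] .
    show "B < \<infinity>" by (rule insert.prems(5))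
    show "s' \<in> A \<rightarrow>\<^sub>E {0..1}" "t' \<in> A \<rightarrow>\<^sub>E {0..1}"
      using insert.prems(7,8) by (auto simp: s'_def t'_def)
  next
    fix x y :: "'n \<Rightarrow> real"
    assume x: "x \<in> A \<rightarrow>\<^sub>E {0..1}" and y: "y \<in> A \<rightarrow>\<^sub>E {0..1}" and fin: "b' x y < \<infinity>"
    let ?w = "ennreal (\<Prod>j\<in>A. q j \<bar>x j - y j\<bar>)"
    let ?phi = "\<lambda>r. partial_increment A (vec_lambda y) f (vec_lambda (x(k := r)))"
    have upd: "z(k := r) \<in> insert k A \<rightarrow>\<^sub>E {0..1}" if "z \<in> A \<rightarrow>\<^sub>E {0..1}" "r \<in> {0..1}" for z r
      using that by (auto simp: PiE_iff extensional_def)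
    have sp: "x \<in> space (PiM A ?L)" "y \<in> space (PiM A ?L)"
      using x y by (auto simp: space_PiM PiE_iff)
    have q_nonneg: "0 \<le> q j \<bar>z\<bar>" for j z
      using monoD[OF q(1), of 0 "\<bar>z\<bar>" j] by (simp add: q(3))
    \<comment> \<open>The one-dimensional bound in coordinate \<open>k\<close>; the factors of the other coordinates are absorbed into \<open>G\<close>.\<close>
    have "ennreal (norm (?phi (s k) - ?phi (t k))) \<le>
        8 * (\<integral>\<^sup>+r\<in>{0..\<bar>s k - t k\<bar>}. ?w * G (4 * b' x y / ennreal (r\<^sup>2)) \<partial>?m k)"
    proof (rule increment_bound_1d[where c = "\<lambda>r v. b (x(k := r)) (y(k := v))", OF _ q])
      have "continuous_on UNIV (\<lambda>r. vec_lambda (x(k := r)))"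
      proof (rule continuous_on_vec_lambda)
        show "continuous_on UNIV (\<lambda>r. (x(k := r)) i)" for i by (cases "i = k") auto
      qed
      then show "continuous_on UNIV ?phi"
        by (intro continuous_partial_increment[OF f] continuous_on_const)
      show "mono (\<lambda>v. ?w * G v)"
        by (intro monoI mult_left_mono monoD[OF G]) auto
      show "(\<lambda>(r, v). b (x(k := r)) (y(k := v))) \<in> borel_measurable (lborel \<Otimes>\<^sub>M lborel)"
        using sp by measurable
      show "(\<integral>\<^sup>+r. \<integral>\<^sup>+v. b (x(k := r)) (y(k := v)) \<partial>lborel \<partial>lborel) \<le> b' x y"
        by (simp add: b'_def)
      show "b' x y < \<infinity>" by (rule fin)
      show "s k \<in> {0..1}" "t k \<in> {0..1}" by (rule st)+
    next
      fix r v :: real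
      assume r: "r \<in> {0..1}" and v: "v \<in> {0..1}" and fin: "b (x(k := r)) (y(k := v)) < \<infinity>"
      have y_upd: "partial_increment A (vec_lambda (y(k := v))) f z = partial_increment A (vec_lambda y) f z" for z
        by (rule partial_increment_cong) (use insert.hyps(2) in auto)
      have "?phi r - ?phi v = partial_increment (insert k A) (vec_lambda (y(k := v))) f (vec_lambda (x(k := r)))"
        using insert.hyps(2) by (simp add: partial_increment_insert y_upd subst_coord_vec_lambda)
      moreover have "(\<Prod>j\<in>insert k A. q j \<bar>(x(k := r)) j - (y(k := v)) j\<bar>) =
          q k \<bar>r - v\<bar> * (\<Prod>j\<in>A. q j \<bar>x j - y j\<bar>)"
        using insert.hyps by (auto intro!: arg_cong2[where f = "(*)"] prod.cong)
      ultimately show "ennreal (norm (?phi r - ?phi v)) \<le>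
          ennreal (q k \<bar>r - v\<bar>) * (?w * G (b (x(k := r)) (y(k := v))))"
        using insert.prems(6)[OF upd[OF x r] upd[OF y v] fin] q_nonneg
        by (simp add: ennreal_mult prod_nonneg mult.assoc del: fun_upd_apply)
    qed
    also have "\<dots> = ?w * G' (b' x y)"
      unfolding G'_def J_def
      by (simp add: nn_integral_cmult mult.assoc) (simp add: mult.left_commute)
    finally have "ennreal (norm (?phi (s k) - ?phi (t k))) \<le> ?w * G' (b' x y)" .
    moreover have "partial_increment A (vec_lambda y) f' (vec_lambda x) = ?phi (t k) - ?phi (s k)"
      unfolding f'_def using insert.hyps(2)
      by (simp add: partial_increment_diff_subst subst_coord_vec_lambda)
    ultimately show "ennreal (norm (partial_increment A (vec_lambda y) f' (vec_lambda x))) \<le> ?w * G' (b' x y)"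
      by (simp add: norm_minus_commute)
  qed
  have t_upd: "t'(k := t k) = t"
    using insert.prems(8) insert.hyps(2) by (auto simp: t'_def fun_eq_iff PiE_iff extensional_def)
  have st_upd: "t'(k := s k) = t(k := s k)"
    using t_upd by (metis fun_upd_upd)
  have "partial_increment A (vec_lambda s') f z = partial_increment A (vec_lambda s) f z" for z
    by (rule partial_increment_cong) (auto simp: s'_def)
  then have lhs: "partial_increment A (vec_lambda s') f' (vec_lambda t') =
      partial_increment (insert k A) (vec_lambda s) f (vec_lambda t)"
    unfolding f'_def using insert.hyps(2)
    by (simp add: partial_increment_diff_subst partial_increment_insert subst_coord_vec_lambda t_upd st_upd)
  define S where "S j = {0..\<bar>s j - t j\<bar>}" for j
  have S: "(\<Pi> k\<in>A. {0..\<bar>s' k - t' k\<bar>}) = Pi A S" "(\<Pi> j\<in>insert k A. {0..\<bar>s j - t j\<bar>}) = Pi (insert k A) S"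
    by (auto simp: S_def s'_def t'_def Pi_iff)
  let ?F = "\<lambda>u. G (4 ^ card (insert k A) * B / (\<Prod>j\<in>insert k A. ennreal ((u j)\<^sup>2))) *
      (\<Prod>j\<in>insert k A. indicator (S j) (u j))"
  have [measurable]: "S j \<in> sets borel" for j by (simp add: S_def)
  have F_meas: "?F \<in> borel_measurable (PiM (insert k A) ?m)"
  proof -
    have [measurable]: "(\<lambda>u. u j) \<in> borel_measurable (PiM (insert k A) ?m)" if "j \<in> insert k A" for j
      using measurable_component_singleton[OF that, of ?m]
      by (simp cong: measurable_cong_sets)
    show ?thesis by measurable
  qed
  have F_meas1: "(\<lambda>u. \<integral>\<^sup>+r. ?F (u(k := r)) \<partial>?m k) \<in> borel_measurable (PiM A ?m)"
  proof (rule sigma_finite_measure.borel_measurable_nn_integral[OF M.sigma_finite_measures])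
    show "(\<lambda>(u, r). ?F (u(k := r))) \<in> borel_measurable (PiM A ?m \<Otimes>\<^sub>M ?m k)"
      using measurable_compose[OF measurable_add_dim F_meas] by (simp add: case_prod_unfold)
  qed
  \<comment> \<open>The division by \<open>r\<^sup>2\<close> may be separated even at \<open>r = 0\<close>, since neither factor of the denominator is \<open>\<infinity>\<close>.\<close>
  have F: "?F (u(k := r)) = (G (4 * (4 ^ card A * B / (\<Prod>j\<in>A. ennreal ((u j)\<^sup>2))) / ennreal (r\<^sup>2)) *
      indicator J r) * (\<Prod>j\<in>A. indicator (S j) (u j))" for u r
  proof -
    let ?P = "\<Prod>j\<in>A. ennreal ((u j)\<^sup>2)"
    have "?P < top" by (simp add: prod_ennreal)
    then have "inverse (?P * ennreal (r\<^sup>2)) = inverse ?P * inverse (ennreal (r\<^sup>2))"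
      by (rule ennreal_inverse_mult) simp
    then have "4 ^ card (insert k A) * B / (ennreal (r\<^sup>2) * ?P) =
        4 * (4 ^ card A * B / ?P) / ennreal (r\<^sup>2)"
      using insert.hyps by (simp add: divide_ennreal_def mult_ac)
    moreover have "(\<Prod>j\<in>insert k A. ennreal (((u(k := r)) j)\<^sup>2)) = ennreal (r\<^sup>2) * ?P"
      using insert.hyps by (auto intro!: arg_cong2[where f = "(*)"] prod.cong)
    moreover have "(\<Prod>j\<in>insert k A. indicator (S j) ((u(k := r)) j) :: ennreal) =
        indicator J r * (\<Prod>j\<in>A. indicator (S j) (u j))"
      using insert.hyps by (auto simp: S_def J_def intro!: arg_cong2[where f = "(*)"] prod.cong)
    ultimately show ?thesis by (simp add: mult_ac del: fun_upd_apply)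
  qed
  have "8 ^ card A * (\<integral>\<^sup>+u. G' (4 ^ card A * B / (\<Prod>j\<in>A. ennreal ((u j)\<^sup>2))) *
      (\<Prod>j\<in>A. indicator (S j) (u j)) \<partial>PiM A ?m) =
      8 ^ card A * (\<integral>\<^sup>+u. 8 * (\<integral>\<^sup>+r. ?F (u(k := r)) \<partial>?m k) \<partial>PiM A ?m)"
    unfolding F G'_def J_def by (subst nn_integral_multc) (simp_all add: mult.assoc)
  also have "\<dots> = 8 ^ card A * (8 * (\<integral>\<^sup>+u. \<integral>\<^sup>+r. ?F (u(k := r)) \<partial>?m k \<partial>PiM A ?m))"
    by (subst nn_integral_cmult[OF F_meas1]) (rule refl)
  also have "\<dots> = 8 ^ card (insert k A) * (\<integral>\<^sup>+u. ?F u \<partial>PiM (insert k A) ?m)"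
    using insert.hyps by (simp only: M.product_nn_integral_insert[OF insert.hyps F_meas]) (simp add: mult_ac)
  finally show ?case
    using IH unfolding S lhs by (simp only: indicator_Pi_eq_prod insert.hyps(1) finite_insert)
qed

section \<open>From the abstract inequality to the integral condition\<close>

text \<open>A rectangular increment only evaluates \<open>f\<close> at the vertices of the rectangle.\<close>

lemma partial_increment_cong_cbox:
  fixes A :: "'n::finite set"
  assumes fg: "\<And>z. z \<in> cbox a b \<Longrightarrow> f z = g z" and y: "y \<in> cbox a b" and x: "x \<in> cbox a b"
  shows "partial_increment A y f x = partial_increment A y g x"
  using finite[of A] x
proof (induction A arbitrary: x rule: finite_induct)
  case (insert k A)
  have "subst_coord k y x \<in> cbox a b"
    using insert.prems y by (auto simp: mem_box_cart subst_coord_def)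
  then show ?case using insert by (simp add: partial_increment_insert)
qed (simp add: fg)

lemma vec_lambda_measurable:
  "vec_lambda \<in> borel_measurable (PiM (UNIV :: 'n::finite set) (\<lambda>_. lborel :: real measure))"
proof -
  have "(\<lambda>u. vec_lambda u \<bullet> axis i 1) \<in> borel_measurable (PiM (UNIV :: 'n set) (\<lambda>_. lborel :: real measure))" for i
    by (simp add: inner_axis)
  then show ?thesis
    unfolding borel_measurable_euclidean_space[of vec_lambda] by (auto simp: Basis_vec_def)
qed

text \<open>Lebesgue measure on \<open>real ^ 'n\<close> is a product over the index type itself, rather than over the
  set \<open>Basis\<close> used in its definition; the two measures agree on boxes.\<close>

lemma lborel_vec_eq_distr_PiM:
  "(lborel :: (real ^ 'n::finite) measure) = distr (PiM UNIV (\<lambda>_. lborel)) borel vec_lambda"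
proof (rule lborel_eqI)
  interpret L: product_sigma_finite "\<lambda>_::'n. lborel :: real measure" by standard
  fix l u :: "real ^ 'n"
  assume "\<And>b. b \<in> Basis \<Longrightarrow> l \<bullet> b \<le> u \<bullet> b"
  then have le: "l $ i \<le> u $ i" for i
    using axis_in_Basis_iff[of i "1::real"] by (metis Basis_real_def cart_eq_inner_axis singletonI)
  have Basis: "(Basis :: (real ^ 'n) set) = (\<lambda>i. axis i 1) ` UNIV"
    by (auto simp: Basis_vec_def)
  have inj: "inj (\<lambda>i. axis i (1::real) :: real ^ 'n)"
    by (auto simp: inj_on_def axis_eq_axis)
  have "vec_lambda -` box l u \<inter> space (PiM UNIV (\<lambda>_. lborel)) = (\<Pi>\<^sub>E i\<in>UNIV. {l $ i<..<u $ i})"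
    by (auto simp: mem_box_cart space_PiM PiE_iff)
  then have "emeasure (distr (PiM UNIV (\<lambda>_. lborel)) borel vec_lambda) (box l u) = (\<Prod>i\<in>UNIV. ennreal (u $ i - l $ i))"
    by (simp add: emeasure_distr vec_lambda_measurable L.emeasure_PiM le)
  also have "\<dots> = ennreal (\<Prod>b\<in>Basis. (u - l) \<bullet> b)"
    unfolding Basis by (simp add: prod.reindex[OF inj] inner_axis prod_ennreal le)
  finally show "emeasure (distr (PiM UNIV (\<lambda>_. lborel)) borel vec_lambda) (box l u) = ennreal (\<Prod>b\<in>Basis. (u - l) \<bullet> b)" .
qed simp

lemma nn_integral_lborel_vec:
  fixes g :: "real ^ 'n::finite \<Rightarrow> ennreal"
  assumes "g \<in> borel_measurable borel"
  shows "(\<integral>\<^sup>+x. g x \<partial>lborel) = (\<integral>\<^sup>+u. g (vec_lambda u) \<partial>PiM UNIV (\<lambda>_. lborel))"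
  by (subst lborel_vec_eq_distr_PiM) (simp add: nn_integral_distr vec_lambda_measurable assms)

lemma mono_ext_Psi:
  assumes "mono_on {0..} \<Psi>"
  shows "mono (ext_Psi \<Psi>)"
proof (rule monoI)
  fix u v :: ennreal assume "u \<le> v"
  then show "ext_Psi \<Psi> u \<le> ext_Psi \<Psi> v"
    unfolding ext_Psi_def
    by (auto intro!: ennreal_leI mono_onD[OF assms] enn2real_mono simp: top_unique less_top)
qed

lemma mono_gen_inverse: "mono (gen_inverse \<Psi>)"
  unfolding gen_inverse_def by (intro monoI SUP_subset_mono) (auto intro: order_trans)

text \<open>The passage from \<open>\<Psi>\<close> to its inverse: for \<open>w > 0\<close> the number \<open>a / w\<close> belongs to the set whose
  supremum is the generalized inverse at \<open>\<Psi> (a / w)\<close>, and for \<open>w = 0\<close> finiteness forces \<open>a = 0\<close>.\<close>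

lemma le_mult_gen_inverse:
  assumes nonneg: "0 \<le> a" "0 \<le> w"
    and fin: "ext_Psi \<Psi> (ennreal a / ennreal w) < \<infinity>"
  shows "ennreal a \<le> ennreal w * gen_inverse \<Psi> (ext_Psi \<Psi> (ennreal a / ennreal w))"
proof (cases "w = 0")
  case True
  then have "a = 0" using fin nonneg by (auto simp: ext_Psi_def ennreal_eq_0_iff split: if_splits)
  then show ?thesis by simp
next
  case False
  with nonneg have w: "0 < w" by simp
  let ?v = "a / w"
  have quot: "ennreal a / ennreal w = ennreal ?v" using nonneg w by (simp add: divide_ennreal)
  have "ennreal ?v \<le> gen_inverse \<Psi> (ext_Psi \<Psi> (ennreal ?v))"
    unfolding gen_inverse_def using nonneg by (intro SUP_upper) (auto simp: ext_Psi_def)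
  then have "ennreal w * ennreal ?v \<le> ennreal w * gen_inverse \<Psi> (ext_Psi \<Psi> (ennreal ?v))"
    by (rule mult_left_mono) simp
  moreover have "ennreal w * ennreal ?v = ennreal a" using nonneg w by (simp flip: ennreal_mult)
  ultimately show ?thesis by (simp add: quot)
qed

theorem theorem2p3:
  fixes \<Psi> :: "real \<Rightarrow> real"
    and p :: "'n::finite \<Rightarrow> real \<Rightarrow> real"
    and f :: "real ^ 'n \<Rightarrow> real ^ 'm"
    and B :: ennreal
    and s t :: "real ^ 'n"
  assumes Psi_nonneg: "\<And>u. 0 \<le> u \<Longrightarrow> 0 \<le> \<Psi> u"
    and Psi_mono: "mono_on {0..} \<Psi>"
    and Psi_lim: "filterlim \<Psi> at_top at_top"
    and p_range: "\<And>k. p k ` {0..1} \<subseteq> {0..1}"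
    and p_cont: "\<And>k. continuous_on {0..1} (p k)"
    and p_mono: "\<And>k. mono_on {0..1} (p k)"
    and p_zero: "\<And>k. p k 0 = 0"
    and f_cont: "continuous_on (cbox 0 1) f"
    and bound: "(\<integral>\<^sup>+x\<in>cbox 0 1. (\<integral>\<^sup>+y\<in>cbox 0 1.
        ext_Psi \<Psi> (ennreal (norm (rect_increment y f x)) /
          ennreal (\<Prod>k\<in>UNIV. p k \<bar>x $ k - y $ k\<bar>)) \<partial>lborel) \<partial>lborel) \<le> B"
    and B_finite: "B < \<infinity>"
    and s: "s \<in> cbox 0 1"
    and t: "t \<in> cbox 0 1"
  shows "ennreal (norm (rect_increment s f t)) \<le>
    8 ^ CARD('n) * (\<integral>\<^sup>+u\<in>(\<Pi> k\<in>UNIV. {0..\<bar>s $ k - t $ k\<bar>}).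
      gen_inverse \<Psi> (4 ^ CARD('n) * B / (\<Prod>k\<in>UNIV. ennreal ((u k)\<^sup>2)))
      \<partial>(\<Pi>\<^sub>M k\<in>UNIV. stieltjes (p k)))"
proof -
  \<comment> \<open>Extending \<open>p\<close> and \<open>f\<close> continuously from \<open>[0,1]\<close> and the cube makes all functions globally continuous,\<close>
  \<comment> \<open>hence measurable, and \<open>stieltjes (p k)\<close> is the interval measure of \<open>q k\<close> by definition.\<close>
  define q where "q k u = p k (max 0 (min 1 u))" for k u
  define fc where "fc x = f (clamp 0 1 x)" for x
  have q: "mono (q k)" "continuous_on UNIV (q k)" "q k 0 = 0" for k
  proof -
    show "mono (q k)"
      unfolding q_def by (intro monoI mono_onD[OF p_mono[of k]]) auto
    show "continuous_on UNIV (q k)"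
      unfolding q_def by (intro continuous_on_compose2[OF p_cont[of k]] continuous_intros) auto
    show "q k 0 = 0" by (simp add: q_def p_zero)
  qed
  have q_nonneg: "0 \<le> q k \<bar>u\<bar>" for k u
    using monoD[OF q(1), of 0 "\<bar>u\<bar>" k] by (simp add: q(3))
  have fc: "continuous_on UNIV fc"
    unfolding fc_def by (rule clamp_continuous_on[OF f_cont])
  have incr: "rect_increment y f x = partial_increment UNIV y fc x"
    if "x \<in> cbox 0 1" "y \<in> cbox 0 1" for x y
    unfolding rect_increment_eq_partial
    by (rule partial_increment_cong_cbox[OF _ that(2,1)]) (simp add: fc_def)
  have q_eq: "p k \<bar>x $ k - y $ k\<bar> = q k \<bar>x $ k - y $ k\<bar>"
    if "x \<in> cbox 0 1" "y \<in> cbox 0 1" for x y k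
  proof -
    have "0 \<le> x $ k" "x $ k \<le> 1" "0 \<le> y $ k" "y $ k \<le> 1"
      using that by (auto simp: mem_box_cart)
    then have "\<bar>x $ k - y $ k\<bar> \<le> 1" by linarith
    then show ?thesis by (simp add: q_def)
  qed
  define h where "h x y = ext_Psi \<Psi> (ennreal (norm (partial_increment UNIV y fc x)) /
      ennreal (\<Prod>k\<in>UNIV. q k \<bar>x $ k - y $ k\<bar>))" for x y
  \<comment> \<open>The indicators turn the integral over the cube into one over the whole space.\<close>
  define g where "g x y = h x y * indicator (cbox 0 1) y * indicator (cbox 0 1) x" for x y :: "real ^ 'n"
  have g_meas: "case_prod g \<in> borel_measurable (borel \<Otimes>\<^sub>M borel)"
  proof -
    have "continuous_on UNIV (\<lambda>z. norm (partial_increment UNIV (snd z) fc (fst z)))"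
      by (intro continuous_intros continuous_partial_increment[OF fc])
    then have [measurable]: "(\<lambda>z. norm (partial_increment UNIV (snd z) fc (fst z))) \<in> borel_measurable (borel \<Otimes>\<^sub>M borel)"
      unfolding borel_prod by (rule borel_measurable_continuous_onI)
    have "continuous_on UNIV (\<lambda>z :: (real ^ 'n) \<times> (real ^ 'n). \<Prod>k\<in>UNIV. q k \<bar>fst z $ k - snd z $ k\<bar>)"
      by (intro continuous_intros continuous_on_compose2[OF q(2)]) auto
    then have [measurable]: "(\<lambda>z :: (real ^ 'n) \<times> (real ^ 'n). \<Prod>k\<in>UNIV. q k \<bar>fst z $ k - snd z $ k\<bar>) \<in>
        borel_measurable (borel \<Otimes>\<^sub>M borel)"
      unfolding borel_prod by (rule borel_measurable_continuous_onI)
    note [measurable] = borel_measurable_mono_ennreal[OF mono_ext_Psi[OF Psi_mono]]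
    show ?thesis unfolding g_def h_def case_prod_unfold by measurable
  qed
  note [measurable] = g_meas
  define b where "b u v = g (vec_lambda u) (vec_lambda v)" for u v
  let ?L = "PiM (UNIV :: 'n set) (\<lambda>_. lborel :: real measure)"
  have b_meas: "case_prod b \<in> borel_measurable (?L \<Otimes>\<^sub>M ?L)"
  proof -
    note [measurable] = vec_lambda_measurable
    show ?thesis unfolding b_def by measurable
  qed
  have g_meas1: "g x \<in> borel_measurable borel" for x by measurable
  have "(\<integral>\<^sup>+u. \<integral>\<^sup>+v. b u v \<partial>?L \<partial>?L) = (\<integral>\<^sup>+x. \<integral>\<^sup>+y. g x y \<partial>lborel \<partial>lborel)"
  proof -
    have "(\<lambda>x. \<integral>\<^sup>+y. g x y \<partial>lborel) \<in> borel_measurable borel" by measurable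
    then show ?thesis
      by (simp add: b_def nn_integral_lborel_vec g_meas1)
  qed
  also have "\<dots> = (\<integral>\<^sup>+x\<in>cbox 0 1. (\<integral>\<^sup>+y\<in>cbox 0 1.
        ext_Psi \<Psi> (ennreal (norm (rect_increment y f x)) /
          ennreal (\<Prod>k\<in>UNIV. p k \<bar>x $ k - y $ k\<bar>)) \<partial>lborel) \<partial>lborel)"
  proof (intro nn_integral_cong)
    fix x :: "real ^ 'n"
    show "(\<integral>\<^sup>+y. g x y \<partial>lborel) = (\<integral>\<^sup>+y\<in>cbox 0 1.
        ext_Psi \<Psi> (ennreal (norm (rect_increment y f x)) /
          ennreal (\<Prod>k\<in>UNIV. p k \<bar>x $ k - y $ k\<bar>)) \<partial>lborel) * indicator (cbox 0 1) x"
    proof (cases "x \<in> cbox 0 1")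
      case True
      then show ?thesis
        by (auto simp: g_def h_def incr q_eq indicator_def intro!: nn_integral_cong)
    qed (simp add: g_def)
  qed
  finally have int: "(\<integral>\<^sup>+u. \<integral>\<^sup>+v. b u v \<partial>?L \<partial>?L) \<le> B" using bound by simp
  have "ennreal (norm (partial_increment UNIV (vec_lambda (vec_nth s)) fc (vec_lambda (vec_nth t)))) \<le>
    8 ^ CARD('n) * (\<integral>\<^sup>+u\<in>(\<Pi> k\<in>UNIV. {0..\<bar>s $ k - t $ k\<bar>}).
      gen_inverse \<Psi> (4 ^ CARD('n) * B / (\<Prod>k\<in>UNIV. ennreal ((u k)\<^sup>2)))
      \<partial>PiM UNIV (\<lambda>k. interval_measure (q k)))"
  proof (rule partial_increment_bound[OF q fc mono_gen_inverse b_meas int B_finite])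
    show "vec_nth s \<in> UNIV \<rightarrow>\<^sub>E {0..1}" "vec_nth t \<in> UNIV \<rightarrow>\<^sub>E {0..1}"
      using s t by (auto simp: mem_box_cart)
  next
    fix x y :: "'n \<Rightarrow> real"
    assume xy: "x \<in> UNIV \<rightarrow>\<^sub>E {0..1}" "y \<in> UNIV \<rightarrow>\<^sub>E {0..1}" and fin: "b x y < \<infinity>"
    have "vec_lambda x \<in> cbox 0 1" "vec_lambda y \<in> cbox 0 1"
      using xy by (auto simp: mem_box_cart)
    then have b: "b x y = h (vec_lambda x) (vec_lambda y)" by (simp add: b_def g_def)
    show "ennreal (norm (partial_increment UNIV (vec_lambda y) fc (vec_lambda x))) \<le>
        ennreal (\<Prod>k\<in>UNIV. q k \<bar>x k - y k\<bar>) * gen_inverse \<Psi> (b x y)"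
      using le_mult_gen_inverse[OF norm_ge_zero prod_nonneg fin[unfolded b h_def]] q_nonneg
      by (simp add: b h_def)
  qed
  then show ?thesis
    by (simp add: vec_nth_inverse incr[OF t s] stieltjes_def q_def[abs_def])
qed

end
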